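(* Let $M$ be a discrete-time, finite, irreducible, aperiodic, reversible, loop-free Markov chain on a state space $\mathcal{X}$, with commute times $c_{xy}$ ($x,y\in\mathcal{X}$) and Kemeny's constant $K$. Let $S$ be the $(|\mathcal{X}|-1)$-dimensional simplex in $\mathbb{R}^{|\mathcal{X}|-1}$ with vertices $(v_x)_{x\in\mathcal{X}}$ (affinely independent points indexed by the states) whose squared edge lengths are given by the commute times, i.e. $\Vert v_x-v_y\Vert_2^2=c_{xy}$ for all $x,y\in\mathcal{X}$. Let $\gamma$ be the circumcenter of $S$, at distance $R$ from each vertex of $S$, and let $\ell$ be the Lemoine point of $S$. Then $$K = R^2-\Vert \gamma-\ell\Vert_2^2 .$$
   Context: A finite discrete-time Markov chain $M=(X_k)_{k\in\mathbb{N}}$ on a finite state space $\mathcal{X}$ is given by a transition matrix $P$ with $P_{xy}=\Pr[X_{k+1}=y\mid X_k=x]$ (and an initial distribution). It is irreducible and aperiodic if there is a finite $t_0>0$ such that for all integers $t\ge t_0$ all entries of $P^t$ are positive; then it has a unique stationary distribution $\pi$. It is loop-free if $P_{xx}=0$ for every state $x$, and reversible if $P_{xy}\pi(x)=P_{yx}\pi(y)$ for all states $x,y$. The hitting time is $h_{xy}=\mathbb{E}\left(\min\{t\in\mathbb{N} : X_t=y\}\right)$ for the chain started at $X_0=x$ (here $0\in\mathbb{N}$, so $h_{xx}=0$). The commute time is $c_{xy}=h_{xy}+h_{yx}$. The value $\sum_{y\in\mathcal{X}}\pi(y)h_{xy}$ is known to be independent of $x$ for a finite, irreducible, aperiodic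 chain; this common value is Kemeny's constant $K$. For a chain as in the claim, a simplex $S$ with squared edge lengths $c_{xy}$ exists, and it is determined up to isometry by its edge lengths. For a $d$-dimensional simplex $S\subset\mathbb{R}^d$ (the convex hull of $d+1$ affinely independent points, its vertices), the circumcenter is the unique point of $\mathbb{R}^d$ at equal distance $R$ from all vertices. A facet is the convex hull of all vertices but one. The Lemoine point is the unique point of $\mathbb{R}^d$ that minimizes the sum, over all facets of $S$, of the squared distance to the facet, where the distance to a facet is the Euclidean distance to the hyperplane (affine hull) spanned by that facet. *)

theory Defs
  imports "HOL-Probability.Probability"
begin

section \<open>Finite Markov chains\<close>

text \<open>The power operation on \<open>real ^ 'a ^ 'a\<close> is entrywise, so matrix powers are spelled out
  with \<open>**\<close>.\<close>

definition matrix_power :: "real ^ 'a ^ 'a \<Rightarrow> nat \<Rightarrow> real ^ ('a::finite) ^ 'a" where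
  "matrix_power P t = ((\<lambda>A. A ** P) ^^ t) (mat 1)"

definition transition_matrix :: "real ^ ('a::finite) ^ 'a \<Rightarrow> bool" where
  "transition_matrix P \<longleftrightarrow> (\<forall>x y. 0 \<le> P $ x $ y) \<and> (\<forall>x. (\<Sum>y\<in>UNIV. P $ x $ y) = 1)"

definition irreducible_aperiodic :: "real ^ ('a::finite) ^ 'a \<Rightarrow> bool" where
  "irreducible_aperiodic P \<longleftrightarrow> (\<exists>t0>0. \<forall>t\<ge>t0. \<forall>x y. 0 < matrix_power P t $ x $ y)"

definition loop_free_matrix :: "real ^ ('a::finite) ^ 'a \<Rightarrow> bool" where
  "loop_free_matrix P \<longleftrightarrow> (\<forall>x. P $ x $ x = 0)"

definition stationary_distribution :: "real ^ ('a::finite) ^ 'a \<Rightarrow> real ^ 'a \<Rightarrow> bool" where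
  "stationary_distribution P \<pi> \<longleftrightarrow>
     (\<forall>x. 0 \<le> \<pi> $ x) \<and> (\<Sum>x\<in>UNIV. \<pi> $ x) = 1 \<and> \<pi> v* P = \<pi>"

definition reversible :: "real ^ ('a::finite) ^ 'a \<Rightarrow> real ^ 'a \<Rightarrow> bool" where
  "reversible P \<pi> \<longleftrightarrow> (\<forall>x y. P $ x $ y * \<pi> $ x = P $ y $ x * \<pi> $ y)"

text \<open>\<open>X\<close> is a time-homogeneous Markov chain with transition matrix \<open>P\<close> on the probability
  space \<open>M\<close>; the initial distribution is the law of \<open>X 0\<close> and is left arbitrary.\<close>

definition markov_chain ::
  "'w measure \<Rightarrow> (nat \<Rightarrow> 'w \<Rightarrow> 'a) \<Rightarrow> real ^ ('a::finite) ^ 'a \<Rightarrow> bool" where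
  "markov_chain M X P \<longleftrightarrow>
     prob_space M \<and> transition_matrix P \<and>
     (\<forall>k. X k \<in> measurable M (count_space UNIV)) \<and>
     (\<forall>k s y. \<P>(\<omega> in M. \<forall>i\<le>k. X i \<omega> = s i) > 0 \<longrightarrow>
        \<P>(\<omega> in M. X (Suc k) \<omega> = y \<bar> \<forall>i\<le>k. X i \<omega> = s i) = P $ s k $ y)"

definition markov_chain_from ::
  "'w measure \<Rightarrow> (nat \<Rightarrow> 'w \<Rightarrow> 'a) \<Rightarrow> real ^ ('a::finite) ^ 'a \<Rightarrow> 'a \<Rightarrow> bool" where
  "markov_chain_from M X P x \<longleftrightarrow> markov_chain M X P \<and> (AE \<omega> in M. X 0 \<omega> = x)"

text \<open>The infimum is taken in the extended nonnegative reals, so the first hitting time is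
  \<open>\<infinity>\<close> on paths that never visit \<open>y\<close>. The expectation is finite for an irreducible
  finite chain, so \<open>enn2real\<close> loses nothing there.\<close>

definition first_hit :: "(nat \<Rightarrow> 'w \<Rightarrow> 'a) \<Rightarrow> 'a \<Rightarrow> 'w \<Rightarrow> ennreal" where
  "first_hit X y \<omega> = (INF t\<in>{t. X t \<omega> = y}. of_nat t)"

definition expected_hit :: "'w measure \<Rightarrow> (nat \<Rightarrow> 'w \<Rightarrow> 'a) \<Rightarrow> 'a \<Rightarrow> real" where
  "expected_hit M X y = enn2real (\<integral>\<^sup>+ \<omega>. first_hit X y \<omega> \<partial>M)"

text \<open>Below, \<open>(M x, X x)\<close> realizes the chain started at \<open>x\<close>.\<close>

definition hitting_time ::
  "('a \<Rightarrow> 'w measure) \<Rightarrow> ('a \<Rightarrow> nat \<Rightarrow> 'w \<Rightarrow> 'a) \<Rightarrow> 'a \<Rightarrow> 'a \<Rightarrow> real" where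
  "hitting_time M X x y = expected_hit (M x) (X x) y"

definition commute_time ::
  "('a \<Rightarrow> 'w measure) \<Rightarrow> ('a \<Rightarrow> nat \<Rightarrow> 'w \<Rightarrow> 'a) \<Rightarrow> 'a \<Rightarrow> 'a \<Rightarrow> real" where
  "commute_time M X x y = hitting_time M X x y + hitting_time M X y x"

definition kemeny_constant ::
  "('a \<Rightarrow> 'w measure) \<Rightarrow> ('a \<Rightarrow> nat \<Rightarrow> 'w \<Rightarrow> 'a) \<Rightarrow> real ^ ('a::finite) \<Rightarrow> real" where
  "kemeny_constant M X \<pi> = (THE K. \<forall>x. (\<Sum>y\<in>UNIV. \<pi> $ y * hitting_time M X x y) = K)"

section \<open>Simplices with indexed vertices\<close>

definition simplex_vertices :: "('a::finite \<Rightarrow> 'e::euclidean_space) \<Rightarrow> bool" where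
  "simplex_vertices v \<longleftrightarrow>
     inj v \<and> \<not> affine_dependent (range v) \<and> CARD('a) = DIM('e) + 1"

text \<open>The facet opposite to the vertex \<open>v x\<close>.\<close>

definition facet :: "('a::finite \<Rightarrow> 'e::euclidean_space) \<Rightarrow> 'a \<Rightarrow> 'e set" where
  "facet v x = convex hull (v ` (UNIV - {x}))"

text \<open>For a simplex there is exactly one such \<open>c\<close> (and \<open>R\<close>), and exactly one Lemoine point.\<close>

definition is_circumcenter :: "('a::finite \<Rightarrow> 'e::euclidean_space) \<Rightarrow> 'e \<Rightarrow> real \<Rightarrow> bool" where
  "is_circumcenter v c R \<longleftrightarrow> (\<forall>x. dist c (v x) = R)"

definition is_lemoine_point :: "('a::finite \<Rightarrow> 'e::euclidean_space) \<Rightarrow> 'e \<Rightarrow> bool" where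
  "is_lemoine_point v l \<longleftrightarrow>
     is_arg_min (\<lambda>p. \<Sum>x\<in>UNIV. (infdist p (affine hull (facet v x)))\<^sup>2) (\<lambda>_. True) l"

end

theory Submission
  imports Defs
begin

text \<open>
  The Lemoine point of the commute-time simplex is the centroid \<open>\<Sum>x. \<pi> x *\<^sub>R v x\<close> of the vertices
  weighted by the stationary distribution. Granting this, the claim is a moment-of-inertia
  computation. For weights summing to one with centroid \<open>l\<close>, Leibniz's identity gives
  \<open>\<Sum>y. \<pi> y \<parallel>p - v y\<parallel>\<^sup>2 = \<parallel>p - l\<parallel>\<^sup>2 + I\<close>, where \<open>I\<close> is the moment of inertia about \<open>l\<close>.
  At the circumcenter it reads \<open>R\<^sup>2 = \<parallel>\<gamma> - l\<parallel>\<^sup>2 + I\<close>. Averaging it over \<open>p = v x\<close> with weights \<open>\<pi>\<close>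
  gives \<open>\<Sum>x y. \<pi> x \<pi> y c x y = 2 I\<close>, and the left-hand side is \<open>2 K\<close> because \<open>c x y = h x y + h y x\<close>.
  So \<open>K = I\<close> (\<open>leibniz_identity\<close>, \<open>kemeny_eq_circumradius\<close>).

  To locate the Lemoine point, let \<open>b\<close> be barycentric coordinates of a point and \<open>H x\<close> the height of
  the simplex over the facet opposite to \<open>v x\<close>. The distance to that facet is \<open>\<bar>b x\<bar> H x\<close>, and
  \<open>\<Sum>x. (b x)\<^sup>2 (H x)\<^sup>2\<close> subject to \<open>\<Sum>x. b x = 1\<close> is minimal exactly when \<open>b x\<close> is proportional to
  \<open>1 / (H x)\<^sup>2\<close>. What has to be shown is therefore \<open>(H x)\<^sup>2 = 1 / \<pi> x\<close>. The vector
  \<open>\<Sum>y. P x y *\<^sub>R (v x - v y)\<close>, which is minus the mean displacement of one step of the chain walking on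
  the vertices, is orthogonal to the facet opposite to \<open>v x\<close> (\<open>facet_normal_inner\<close>), has inner
  product \<open>1 / \<pi> x\<close> with every edge vector \<open>v x - v w\<close>, and has squared length \<open>1 / \<pi> x\<close>; the latter
  uses that the chain has no loops (\<open>facet_normal_norm\<close>).

  These inner products are combinations of commute times and their one-step averages. The average
  of \<open>h\<close> in its first argument is given by first-step analysis and Kac's formula; reversibility
  transfers it to the second argument, since \<open>h x y\<close> becomes symmetric once a function of \<open>y\<close> alone is subtracted
  (\<open>hit_symmetric\<close>). The probabilistic input consists only of the first-step equations, obtained by
  writing the expected hitting time as the sum over \<open>k\<close> of the probability that the target is
  avoided up to time \<open>k\<close>.
\<close>

section \<open>Hitting times as sums of avoidance probabilities\<close>

text \<open>The tail-sum formula, pathwise: the first hitting time counts the times up to which the path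
  has avoided \<open>y\<close>. It includes the paths that never hit, where both sides are infinite.\<close>

lemma first_hit_eq_suminf:
  "first_hit X y \<omega> = (\<Sum>k. of_bool (\<forall>i\<le>k. X i \<omega> \<noteq> y) :: ennreal)"
proof (cases "\<exists>t. X t \<omega> = y")
  case True
  define n where "n = (LEAST t. X t \<omega> = y)"
  have n: "X n \<omega> = y" unfolding n_def using True by (rule LeastI_ex)
  have least: "n \<le> t" if "X t \<omega> = y" for t unfolding n_def using that by (rule Least_le)
  have avoid: "(\<forall>i\<le>k. X i \<omega> \<noteq> y) \<longleftrightarrow> k < n" for k
  proof
    assume "\<forall>i\<le>k. X i \<omega> \<noteq> y"
    with n show "k < n" by (cases "n \<le> k") auto
  next
    assume "k < n"
    then show "\<forall>i\<le>k. X i \<omega> \<noteq> y" using least by (auto dest: leD le_less_trans)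
  qed
  have "first_hit X y \<omega> = of_nat n"
    unfolding first_hit_def
  proof (rule antisym)
    show "(INF t\<in>{t. X t \<omega> = y}. of_nat t) \<le> (of_nat n :: ennreal)"
      by (rule INF_lower) (simp add: n)
    show "(of_nat n :: ennreal) \<le> (INF t\<in>{t. X t \<omega> = y}. of_nat t)"
      by (rule INF_greatest) (simp add: least)
  qed
  moreover have "(\<Sum>k. of_bool (k < n) :: ennreal) = (\<Sum>k\<in>{..<n}. of_bool (k < n))"
    by (rule suminf_finite) auto
  ultimately show ?thesis by (simp add: avoid)
next
  case False
  then have "first_hit X y \<omega> = \<top>" by (simp add: first_hit_def)
  moreover have "(\<Sum>k. 1 :: ennreal) = \<top>"
  proof (rule ccontr)
    assume "(\<Sum>k. 1 :: ennreal) \<noteq> \<top>"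
    then obtain m :: nat where m: "(\<Sum>k. 1 :: ennreal) \<le> of_nat m"
      using ennreal_Ex_less_of_nat[of "\<Sum>k. 1"] by (auto simp: less_top dest: less_imp_le)
    have "(\<Sum>k<Suc m. 1 :: ennreal) \<le> (\<Sum>k. 1)" by (rule sum_le_suminf) auto
    also note m
    finally have "(of_nat (Suc m) :: ennreal) \<le> of_nat m" by simp
    then show False by (simp del: of_nat_Suc)
  qed
  ultimately show ?thesis using False by simp
qed

text \<open>The probability, for the chain started at \<open>x\<close>, of avoiding \<open>y\<close> at the times \<open>0, \<dots>, k\<close>
  (\<open>measure_avoid\<close>). The recursion conditions on the first step, so that summing it over \<open>k\<close> yields
  the first-step equation for expected hitting times.\<close>

primrec avoid_prob :: "real ^ ('a::finite) ^ 'a \<Rightarrow> 'a \<Rightarrow> nat \<Rightarrow> 'a \<Rightarrow> real" where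
  "avoid_prob P y 0 x = of_bool (x \<noteq> y)"
| "avoid_prob P y (Suc k) x = of_bool (x \<noteq> y) * (\<Sum>z\<in>UNIV. P $ x $ z * avoid_prob P y k z)"

lemma avoid_prob_target [simp]: "avoid_prob P y k y = 0"
  by (cases k) auto

text \<open>The defining property of a chain fixes a single complete history. Here the history is only
  constrained to stay in \<open>A\<close>; this is still a finite disjoint union of complete histories, all
  ending in \<open>z\<close> and hence all continuing to \<open>w\<close> with the same probability. Histories of probability
  zero, on which the defining property is silent, contribute nothing.\<close>

lemma measure_path_step:
  assumes "markov_chain M X P"
  shows "measure M {\<omega>\<in>space M. (\<forall>i\<le>k. X i \<omega> \<in> A) \<and> X k \<omega> = z \<and> X (Suc k) \<omega> = w}
       = measure M {\<omega>\<in>space M. (\<forall>i\<le>k. X i \<omega> \<in> A) \<and> X k \<omega> = z} * P $ z $ w"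
proof -
  interpret prob_space M using assms by (simp add: markov_chain_def)
  have X [measurable]: "X i \<in> measurable M (count_space UNIV)" for i
    using assms by (simp add: markov_chain_def)
  define E where "E s = {\<omega>\<in>space M. \<forall>i\<le>k. X i \<omega> = s i}" for s
  define F where "F = {\<omega>\<in>space M. X (Suc k) \<omega> = w}"
  define S where "S = {s \<in> {..k} \<rightarrow>\<^sub>E A. s k = z}"
  have [measurable]: "E s \<in> sets M" "F \<in> sets M" for s unfolding E_def F_def by measurable
  have path: "measure M (E s \<inter> F) = measure M (E s) * P $ s k $ w" for s
  proof (cases "measure M (E s) = 0")
    case True
    then have "measure M (E s \<inter> F) = 0"
      using finite_measure_mono[of "E s \<inter> F" "E s"] by (simp add: measure_le_0_iff)
    with True show ?thesis by simp
  next
    case False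
    then have "measure M (E s) > 0" by (simp add: zero_less_measure_iff)
    then have "\<P>(\<omega> in M. X (Suc k) \<omega> = w \<bar> \<forall>i\<le>k. X i \<omega> = s i) = P $ s k $ w"
      using assms unfolding markov_chain_def E_def by blast
    moreover have "E s \<inter> F = {\<omega>\<in>space M. X (Suc k) \<omega> = w \<and> (\<forall>i\<le>k. X i \<omega> = s i)}"
      by (auto simp: E_def F_def)
    ultimately show ?thesis using False
      by (simp add: cond_prob_def E_def[symmetric] field_simps)
  qed
  have fin: "finite S"
    unfolding S_def by (rule finite_subset[of _ "{..k} \<rightarrow>\<^sub>E A"]) (auto intro!: finite_PiE)
  have disj: "disjoint_family_on E S"
  proof (unfold disjoint_family_on_def, intro ballI impI)
    fix s t assume st: "s \<in> S" "t \<in> S" "s \<noteq> t"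
    have "\<exists>i\<le>k. s i \<noteq> t i"
    proof (rule ccontr)
      assume "\<not> ?thesis"
      then have "s = t" using st PiE_ext[of s "{..k}" "\<lambda>_. A" t] by (auto simp: S_def)
      with st show False by simp
    qed
    then show "E s \<inter> E t = {}" by (auto simp: E_def)
  qed
  have un: "{\<omega>\<in>space M. (\<forall>i\<le>k. X i \<omega> \<in> A) \<and> X k \<omega> = z} = (\<Union>s\<in>S. E s)"
  proof (intro equalityI subsetI)
    fix \<omega> assume \<omega>: "\<omega> \<in> {\<omega>\<in>space M. (\<forall>i\<le>k. X i \<omega> \<in> A) \<and> X k \<omega> = z}"
    then have "(\<lambda>i\<in>{..k}. X i \<omega>) \<in> S" "\<omega> \<in> E (\<lambda>i\<in>{..k}. X i \<omega>)"
      by (auto simp: S_def E_def)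
    then show "\<omega> \<in> (\<Union>s\<in>S. E s)" by blast
  qed (auto simp: S_def E_def PiE_iff)
  have "{\<omega>\<in>space M. (\<forall>i\<le>k. X i \<omega> \<in> A) \<and> X k \<omega> = z \<and> X (Suc k) \<omega> = w} = (\<Union>s\<in>S. E s \<inter> F)"
    using un unfolding F_def by blast
  also have "measure M \<dots> = (\<Sum>s\<in>S. measure M (E s \<inter> F))"
    using fin disj by (intro finite_measure_finite_Union) (auto simp: disjoint_family_on_def)
  also have "\<dots> = (\<Sum>s\<in>S. measure M (E s)) * P $ z $ w"
    unfolding path sum_distrib_right by (rule sum.cong) (auto simp: S_def)
  also have "(\<Sum>s\<in>S. measure M (E s)) = measure M (\<Union>s\<in>S. E s)"
    using fin disj by (intro finite_measure_finite_Union[symmetric]) auto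
  finally show ?thesis by (simp add: un)
qed

text \<open>The chain moves forward in time while \<open>avoid_prob\<close> recurses on the first step. The two are
  reconciled by splitting the time span: run the chain for \<open>k\<close> steps, keeping track of its position
  on the event of having avoided \<open>y\<close>, and account for the remaining \<open>j\<close> steps by
  \<open>avoid_prob\<close>. Shifting one step from \<open>j\<close> to \<open>k\<close> does not change the total; at \<open>k = 0\<close> it is the
  claim.\<close>

lemma measure_avoid:
  assumes "markov_chain_from M X P x"
  shows "measure M {\<omega>\<in>space M. \<forall>i\<le>j. X i \<omega> \<noteq> y} = avoid_prob P y j x"
proof -
  have mc: "markov_chain M X P" using assms by (simp add: markov_chain_from_def)
  interpret prob_space M using mc by (simp add: markov_chain_def)
  have X [measurable]: "X i \<in> measurable M (count_space UNIV)" for i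
    using mc by (simp add: markov_chain_def)
  \<comment> \<open>Membership in \<open>- {y}\<close> instead of \<open>\<noteq> y\<close> puts the event in the form of the path lemma.\<close>
  define p where "p k z = measure M {\<omega>\<in>space M. (\<forall>i\<le>k. X i \<omega> \<in> - {y}) \<and> X k \<omega> = z}" for k z
  have p_y: "p k y = 0" for k
  proof -
    have "{\<omega>\<in>space M. (\<forall>i\<le>k. X i \<omega> \<in> - {y}) \<and> X k \<omega> = y} = {}" by auto
    then show ?thesis unfolding p_def by (metis measure_empty)
  qed
  have p_Suc: "p (Suc k) w = (\<Sum>z\<in>UNIV. p k z * P $ z $ w)" if "w \<noteq> y" for k w
  proof -
    have "{\<omega>\<in>space M. (\<forall>i\<le>Suc k. X i \<omega> \<in> - {y}) \<and> X (Suc k) \<omega> = w}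
        = (\<Union>z. {\<omega>\<in>space M. (\<forall>i\<le>k. X i \<omega> \<in> - {y}) \<and> X k \<omega> = z \<and> X (Suc k) \<omega> = w})"
      using that by (auto simp: le_Suc_eq)
    also have "measure M \<dots> =
        (\<Sum>z\<in>UNIV. measure M {\<omega>\<in>space M. (\<forall>i\<le>k. X i \<omega> \<in> - {y}) \<and> X k \<omega> = z \<and> X (Suc k) \<omega> = w})"
      by (intro finite_measure_finite_Union) (auto simp: disjoint_family_on_def)
    finally show ?thesis unfolding p_def measure_path_step[OF mc] .
  qed
  have gen: "measure M {\<omega>\<in>space M. \<forall>i\<le>k + j. X i \<omega> \<noteq> y} = (\<Sum>z\<in>UNIV. p k z * avoid_prob P y j z)"
    for k
  proof (induction j arbitrary: k)
    case 0
    have "{\<omega>\<in>space M. \<forall>i\<le>k. X i \<omega> \<noteq> y}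
        = (\<Union>z. {\<omega>\<in>space M. (\<forall>i\<le>k. X i \<omega> \<in> - {y}) \<and> X k \<omega> = z})" by auto
    also have "measure M \<dots> = (\<Sum>z\<in>UNIV. p k z)"
      unfolding p_def by (intro finite_measure_finite_Union) (auto simp: disjoint_family_on_def)
    also have "\<dots> = (\<Sum>z\<in>UNIV. p k z * avoid_prob P y 0 z)"
      by (rule sum.cong) (auto simp: p_y)
    finally show ?case by simp
  next
    case (Suc j)
    have "measure M {\<omega>\<in>space M. \<forall>i\<le>k + Suc j. X i \<omega> \<noteq> y}
        = (\<Sum>w\<in>UNIV. p (Suc k) w * avoid_prob P y j w)"
      using Suc.IH[of "Suc k"] by simp
    also have "\<dots> = (\<Sum>w\<in>UNIV. \<Sum>z\<in>UNIV. p k z * P $ z $ w * avoid_prob P y j w)"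
    proof (rule sum.cong[OF refl])
      fix w
      show "p (Suc k) w * avoid_prob P y j w = (\<Sum>z\<in>UNIV. p k z * P $ z $ w * avoid_prob P y j w)"
        by (cases "w = y") (simp_all add: p_Suc sum_distrib_right)
    qed
    also have "\<dots> = (\<Sum>z\<in>UNIV. p k z * (\<Sum>w\<in>UNIV. P $ z $ w * avoid_prob P y j w))"
      by (subst sum.swap) (simp add: sum_distrib_left mult.assoc)
    also have "\<dots> = (\<Sum>z\<in>UNIV. p k z * avoid_prob P y (Suc j) z)"
      by (rule sum.cong) (auto simp: p_y)
    finally show ?case .
  qed
  have p_0: "p 0 z = of_bool (z = x \<and> z \<noteq> y)" for z
  proof -
    have ae: "AE \<omega> in M. X 0 \<omega> = x" using assms by (simp add: markov_chain_from_def)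
    have "p 0 z = measure M {\<omega>\<in>space M. z = x \<and> z \<noteq> y}"
      unfolding p_def by (rule finite_measure_eq_AE) (use ae in \<open>auto elim!: eventually_mono\<close>)
    then show ?thesis by (auto simp: prob_space)
  qed
  have "measure M {\<omega>\<in>space M. \<forall>i\<le>j. X i \<omega> \<noteq> y} = (\<Sum>z\<in>UNIV. p 0 z * avoid_prob P y j z)"
    using gen[of 0] by simp
  also have "\<dots> = (\<Sum>z\<in>UNIV. if z = x then avoid_prob P y j z else 0)"
    by (rule sum.cong) (auto simp: p_0)
  finally show ?thesis by simp
qed

lemma transition_nonneg: "transition_matrix P \<Longrightarrow> 0 \<le> P $ x $ y"
  by (simp add: transition_matrix_def)

lemma transition_sum: "transition_matrix P \<Longrightarrow> (\<Sum>y\<in>UNIV. P $ x $ y) = 1"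
  by (simp add: transition_matrix_def)

lemma matrix_power_Suc_left: "matrix_power P (Suc t) = P ** matrix_power P t"
proof (induction t)
  case (Suc t)
  have "matrix_power P (Suc (Suc t)) = matrix_power P (Suc t) ** P" by (simp add: matrix_power_def)
  also have "\<dots> = P ** (matrix_power P t ** P)" by (simp add: Suc matrix_mul_assoc)
  finally show ?case by (simp add: matrix_power_def)
qed (simp add: matrix_power_def)

lemma matrix_power_Suc_entry:
  "matrix_power P (Suc t) $ x $ y = (\<Sum>z\<in>UNIV. P $ x $ z * matrix_power P t $ z $ y)"
  by (simp add: matrix_power_Suc_left matrix_matrix_mult_def)

lemma avoid_prob_nonneg:
  assumes "transition_matrix P"
  shows "0 \<le> avoid_prob P y k x"
  by (induction k arbitrary: x)
     (auto intro!: sum_nonneg mult_nonneg_nonneg transition_nonneg[OF assms])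

text \<open>Avoiding \<open>y\<close> up to time \<open>k\<close> entails not being at \<open>y\<close> at time \<open>k\<close>.\<close>

lemma avoid_prob_le:
  assumes "transition_matrix P"
  shows "avoid_prob P y k x \<le> 1 - matrix_power P k $ x $ y"
proof (induction k arbitrary: x)
  case 0
  show ?case by (simp add: matrix_power_def mat_def)
next
  case (Suc k)
  have "avoid_prob P y (Suc k) x \<le> (\<Sum>z\<in>UNIV. P $ x $ z * avoid_prob P y k z)"
    by (auto intro!: sum_nonneg mult_nonneg_nonneg transition_nonneg[OF assms]
        avoid_prob_nonneg[OF assms])
  also have "\<dots> \<le> (\<Sum>z\<in>UNIV. P $ x $ z * (1 - matrix_power P k $ z $ y))"
    by (intro sum_mono mult_left_mono Suc.IH transition_nonneg[OF assms])
  also have "\<dots> = 1 - matrix_power P (Suc k) $ x $ y"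
    by (simp add: matrix_power_Suc_entry right_diff_distrib sum_subtractf transition_sum[OF assms])
  finally show ?case .
qed

text \<open>If from every state the chance of surviving \<open>t\<close> steps is at most \<open>c\<close>, then \<open>t\<close> further steps
  cost a factor \<open>c\<close>, wherever the chain stands after the first \<open>j\<close>.\<close>

lemma avoid_prob_add_le:
  assumes "transition_matrix P" and c: "\<And>x. avoid_prob P y t x \<le> c"
  shows "avoid_prob P y (j + t) x \<le> c * avoid_prob P y j x"
proof (induction j arbitrary: x)
  case 0
  show ?case using c by (cases "x = y") auto
next
  case (Suc j)
  show ?case
  proof (cases "x = y")
    case False
    have "(\<Sum>z\<in>UNIV. P $ x $ z * avoid_prob P y (j + t) z)
        \<le> (\<Sum>z\<in>UNIV. P $ x $ z * (c * avoid_prob P y j z))"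
      by (intro sum_mono mult_left_mono Suc.IH transition_nonneg[OF assms(1)])
    also have "\<dots> = c * (\<Sum>z\<in>UNIV. P $ x $ z * avoid_prob P y j z)"
      by (simp add: sum_distrib_left mult_ac)
    finally show ?thesis using False by simp
  qed simp
qed

text \<open>Expected hitting times are finite. For a time \<open>t\<close> at which all entries of the matrix power are at
  least some \<open>\<epsilon> > 0\<close> in column \<open>y\<close>, every \<open>t\<close> steps lose a factor \<open>1 - \<epsilon>\<close>. A partial sum \<open>S\<close> thus
  satisfies \<open>S \<le> C + (1 - \<epsilon>) S\<close> with \<open>C\<close> the sum of the first \<open>t\<close> terms, which bounds it by \<open>C / \<epsilon>\<close>.\<close>

lemma summable_avoid_prob:
  assumes P: "transition_matrix P" and "irreducible_aperiodic P"
  shows "summable (\<lambda>k. avoid_prob P y k x)"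
proof -
  obtain t where t: "\<And>x y. 0 < matrix_power P t $ x $ y"
    using assms(2) unfolding irreducible_aperiodic_def by blast
  define \<epsilon> where "\<epsilon> = Min (range (\<lambda>x. matrix_power P t $ x $ y))"
  have "\<epsilon> \<in> range (\<lambda>x. matrix_power P t $ x $ y)" unfolding \<epsilon>_def by (rule Min_in) auto
  then have "\<epsilon> > 0" using t by auto
  have "\<epsilon> \<le> matrix_power P t $ x $ y" for x unfolding \<epsilon>_def by (rule Min_le) auto
  then have "avoid_prob P y t x \<le> 1 - \<epsilon>" for x
    using avoid_prob_le[OF P, of y t x] by (meson diff_left_mono order_trans)
  then have decay: "avoid_prob P y (j + t) x \<le> (1 - \<epsilon>) * avoid_prob P y j x" for j x
    by (rule avoid_prob_add_le[OF P])
  define C where "C = (\<Sum>k<t. avoid_prob P y k x)"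
  have nonneg: "0 \<le> avoid_prob P y k x" for k by (rule avoid_prob_nonneg[OF P])
  show ?thesis
  proof (rule summableI_nonneg_bounded[OF nonneg])
    fix N
    let ?S = "\<Sum>k<N. avoid_prob P y k x"
    have "?S \<le> (\<Sum>k<N + t. avoid_prob P y k x)"
      by (rule sum_mono2) (auto simp: nonneg)
    also have "\<dots> = C + (\<Sum>j<N. avoid_prob P y (j + t) x)"
    proof (induction N)
      case (Suc N) then show ?case by simp
    qed (simp add: C_def)
    also have "\<dots> \<le> C + (\<Sum>j<N. (1 - \<epsilon>) * avoid_prob P y j x)"
      by (intro add_left_mono sum_mono decay)
    also have "\<dots> = C + (1 - \<epsilon>) * ?S" by (simp add: sum_distrib_left)
    finally have "\<epsilon> * ?S \<le> C" by (simp add: algebra_simps)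
    then show "?S \<le> C / \<epsilon>" using \<open>\<epsilon> > 0\<close> by (simp add: field_simps)
  qed
qed

lemma expected_hit_eq_suminf:
  assumes P: "transition_matrix P" "irreducible_aperiodic P"
    and chain: "markov_chain_from M X P x"
  shows "expected_hit M X y = (\<Sum>k. avoid_prob P y k x)"
proof -
  have mc: "markov_chain M X P" using chain by (simp add: markov_chain_from_def)
  interpret prob_space M using mc by (simp add: markov_chain_def)
  have X [measurable]: "X i \<in> measurable M (count_space UNIV)" for i
    using mc by (simp add: markov_chain_def)
  let ?A = "\<lambda>k. {\<omega>\<in>space M. \<forall>i\<le>k. X i \<omega> \<noteq> y}"
  have "(\<integral>\<^sup>+ \<omega>. first_hit X y \<omega> \<partial>M) = (\<integral>\<^sup>+ \<omega>. (\<Sum>k. indicator (?A k) \<omega>) \<partial>M)"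
    by (rule nn_integral_cong) (simp add: first_hit_eq_suminf indicator_def)
  also have "\<dots> = (\<Sum>k. \<integral>\<^sup>+ \<omega>. indicator (?A k) \<omega> \<partial>M)"
    by (rule nn_integral_suminf) measurable
  also have "\<dots> = (\<Sum>k. emeasure M (?A k))" by simp
  also have "\<dots> = (\<Sum>k. ennreal (avoid_prob P y k x))"
    by (simp add: emeasure_eq_measure measure_avoid[OF chain])
  also have "\<dots> = ennreal (\<Sum>k. avoid_prob P y k x)"
    by (rule suminf_ennreal2) (auto intro: avoid_prob_nonneg summable_avoid_prob P)
  finally show ?thesis
    by (simp add: expected_hit_def suminf_nonneg summable_avoid_prob P avoid_prob_nonneg)
qed

lemma suminf_avoid_prob_step:
  assumes P: "transition_matrix P" "irreducible_aperiodic P" and "x \<noteq> y"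
  shows "(\<Sum>k. avoid_prob P y k x) = 1 + (\<Sum>z\<in>UNIV. P $ x $ z * (\<Sum>k. avoid_prob P y k z))"
proof -
  note sm = summable_avoid_prob[OF P]
  have "(\<Sum>k. avoid_prob P y k x) = (\<Sum>k. avoid_prob P y (Suc k) x) + avoid_prob P y 0 x"
    using suminf_split_head[OF sm] by simp
  also have "(\<Sum>k. avoid_prob P y (Suc k) x) = (\<Sum>k. \<Sum>z\<in>UNIV. P $ x $ z * avoid_prob P y k z)"
    using \<open>x \<noteq> y\<close> by simp
  also have "\<dots> = (\<Sum>z\<in>UNIV. \<Sum>k. P $ x $ z * avoid_prob P y k z)"
    by (rule suminf_sum) (rule summable_mult[OF sm])
  also have "\<dots> = (\<Sum>z\<in>UNIV. P $ x $ z * (\<Sum>k. avoid_prob P y k z))"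
    by (simp add: suminf_mult[OF sm])
  finally show ?thesis using \<open>x \<noteq> y\<close> by simp
qed

section \<open>Hitting times of a reversible chain\<close>

text \<open>The first-step equations determine the hitting times of an irreducible chain, so from here on
  they stand in for the process.\<close>

locale reversible_hitting =
  fixes P :: "real ^ ('a::finite) ^ 'a" and \<pi> :: "real ^ 'a" and h :: "'a \<Rightarrow> 'a \<Rightarrow> real"
  assumes P: "transition_matrix P" and irr: "irreducible_aperiodic P"
    and stat: "stationary_distribution P \<pi>" and rev: "reversible P \<pi>"
    and hit_self: "h y y = 0"
    and hit_step: "x \<noteq> y \<Longrightarrow> h x y = 1 + (\<Sum>z\<in>UNIV. P $ x $ z * h z y)"
begin

lemma sum_pi: "(\<Sum>x\<in>UNIV. \<pi> $ x) = 1"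
  using stat by (simp add: stationary_distribution_def)

lemma pi_P: "(\<Sum>x\<in>UNIV. \<pi> $ x * P $ x $ y) = \<pi> $ y"
proof -
  have "\<pi> v* P = \<pi>" using stat by (simp add: stationary_distribution_def)
  then have "(\<pi> v* P) $ y = \<pi> $ y" by simp
  then show ?thesis by (simp add: vector_matrix_mult_def mult.commute)
qed

lemma pi_expect_P: "(\<Sum>x\<in>UNIV. \<pi> $ x * (\<Sum>z\<in>UNIV. P $ x $ z * f z)) = (\<Sum>z\<in>UNIV. \<pi> $ z * f z)"
proof -
  have "(\<Sum>x\<in>UNIV. \<pi> $ x * (\<Sum>z\<in>UNIV. P $ x $ z * f z))
      = (\<Sum>z\<in>UNIV. (\<Sum>x\<in>UNIV. \<pi> $ x * P $ x $ z) * f z)"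
    unfolding sum_distrib_left sum_distrib_right by (subst sum.swap) (simp add: mult.assoc)
  then show ?thesis by (simp add: pi_P)
qed

text \<open>Stationarity for a matrix power with positive entries spreads the mass of one state to all.\<close>

lemma pi_pos: "0 < \<pi> $ y"
proof -
  obtain t where t: "\<And>x y. 0 < matrix_power P t $ x $ y"
    using irr unfolding irreducible_aperiodic_def by blast
  have nonneg: "0 \<le> \<pi> $ x" for x using stat by (simp add: stationary_distribution_def)
  have "(\<Sum>x\<in>UNIV. \<pi> $ x * matrix_power P t $ x $ y) = \<pi> $ y"
  proof (induction t)
    case 0
    have "(\<Sum>x\<in>UNIV. \<pi> $ x * matrix_power P 0 $ x $ y) = (\<Sum>x\<in>UNIV. if x = y then \<pi> $ x else 0)"
      by (rule sum.cong) (auto simp: matrix_power_def mat_def)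
    then show ?case by simp
  next
    case (Suc t)
    then show ?case by (simp add: matrix_power_Suc_entry pi_expect_P)
  qed
  moreover obtain x where "\<pi> $ x \<noteq> 0" using sum_pi by (metis sum.neutral zero_neq_one)
  then have "0 < \<pi> $ x * matrix_power P t $ x $ y" using nonneg[of x] t[of x y] by simp
  moreover have "\<pi> $ x * matrix_power P t $ x $ y \<le> (\<Sum>x\<in>UNIV. \<pi> $ x * matrix_power P t $ x $ y)"
    by (rule member_le_sum) (auto intro!: mult_nonneg_nonneg nonneg less_imp_le[OF t])
  ultimately show ?thesis by linarith
qed

text \<open>Kac's formula: the mean return time to \<open>y\<close> is \<open>1 / \<pi> y\<close>. Averaging the first-step equations over
  \<open>\<pi>\<close>, the means of \<open>h\<close> before and after the step cancel by stationarity, and only the defect at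
  the diagonal remains.\<close>

lemma kac_return_time: "\<pi> $ y * (1 + (\<Sum>z\<in>UNIV. P $ y $ z * h z y)) = 1"
proof -
  let ?r = "1 + (\<Sum>z\<in>UNIV. P $ y $ z * h z y)"
  have "h x y = 1 + (\<Sum>z\<in>UNIV. P $ x $ z * h z y) - of_bool (x = y) * ?r" for x
    using hit_step[of x y] by (auto simp: hit_self)
  then have "(\<Sum>x\<in>UNIV. \<pi> $ x * h x y)
      = (\<Sum>x\<in>UNIV. \<pi> $ x * (1 + (\<Sum>z\<in>UNIV. P $ x $ z * h z y) - of_bool (x = y) * ?r))"
    by (metis (no_types, lifting))
  also have "\<dots> = (\<Sum>x\<in>UNIV. \<pi> $ x) + (\<Sum>x\<in>UNIV. \<pi> $ x * (\<Sum>z\<in>UNIV. P $ x $ z * h z y))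
      - (\<Sum>x\<in>UNIV. if x = y then \<pi> $ x * ?r else 0)"
    unfolding sum.distrib[symmetric] sum_subtractf[symmetric]
    by (rule sum.cong) (auto simp: algebra_simps)
  finally show ?thesis by (simp add: pi_expect_P sum_pi)
qed

text \<open>The first-step equation off the diagonal and Kac's formula on it: the function \<open>\<lambda>x. h x y\<close>
  solves the Poisson equation of the chain with source at \<open>y\<close>.\<close>

lemma expect_hit_after_step: "(\<Sum>z\<in>UNIV. P $ x $ z * h z y) = h x y - 1 + of_bool (x = y) / \<pi> $ y"
proof (cases "x = y")
  case True
  then show ?thesis using kac_return_time[of y] pi_pos[of y] by (simp add: hit_self field_simps)
qed (simp add: hit_step)

text \<open>Maximum principle: \<open>f\<close> is also invariant under a matrix power all of whose entries are positive, so
  its value at a minimum is a strictly positive average of all its values.\<close>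

lemma harmonic_const:
  assumes "\<And>x. (\<Sum>z\<in>UNIV. P $ x $ z * f z) = f x"
  shows "f x = f y"
proof -
  obtain t where t: "\<And>x y. 0 < matrix_power P t $ x $ y"
    using irr unfolding irreducible_aperiodic_def by blast
  \<comment> \<open>Stated for an arbitrary harmonic function because it is applied to \<open>f\<close> minus its minimum.\<close>
  have powf: "(\<Sum>z\<in>UNIV. matrix_power P t $ x $ z * g z) = g x"
    if g: "\<And>x. (\<Sum>z\<in>UNIV. P $ x $ z * g z) = g x" for g x
  proof (induction t arbitrary: x)
    case 0
    have "(\<Sum>z\<in>UNIV. matrix_power P 0 $ x $ z * g z) = (\<Sum>z\<in>UNIV. if z = x then g z else 0)"
      by (rule sum.cong) (auto simp: matrix_power_def mat_def)
    then show ?case by simp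
  next
    case (Suc t)
    have "(\<Sum>z\<in>UNIV. matrix_power P (Suc t) $ x $ z * g z)
        = (\<Sum>w\<in>UNIV. P $ x $ w * (\<Sum>z\<in>UNIV. matrix_power P t $ w $ z * g z))"
      unfolding matrix_power_Suc_entry sum_distrib_left sum_distrib_right
      by (subst sum.swap) (simp add: mult.assoc)
    then show ?case by (simp add: Suc g)
  qed
  have "Min (range f) \<in> range f" by (rule Min_in) auto
  then obtain m where "Min (range f) = f m" by (metis imageE)
  then have m: "f m \<le> f z" for z by (metis Min_le finite finite_imageI rangeI)
  have "f z = f m" for z
  proof -
    have "(\<Sum>z\<in>UNIV. matrix_power P t $ m $ z * (f z - f m)) = f m - f m"
      by (rule powf[of "\<lambda>z. f z - f m"])
         (simp add: right_diff_distrib sum_subtractf assms sum_distrib_right[symmetric] transition_sum[OF P])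
    then have "matrix_power P t $ m $ z * (f z - f m) = 0"
      using sum_nonneg_eq_0_iff[of UNIV "\<lambda>z. matrix_power P t $ m $ z * (f z - f m)"] m
        less_imp_le[OF t] by simp
    then show ?thesis using t[of m z] by simp
  qed
  then show ?thesis by metis
qed

text \<open>Averaging the Poisson equation over its source \<open>y\<close>, the constant \<open>1\<close> and the point masses
  \<open>1 / \<pi> y\<close> balance, so the sum is harmonic in the starting state.\<close>

lemma kemeny_sum_const: "(\<Sum>y\<in>UNIV. \<pi> $ y * h x y) = (\<Sum>y\<in>UNIV. \<pi> $ y * h x' y)"
proof (rule harmonic_const)
  fix x
  have "(\<Sum>z\<in>UNIV. P $ x $ z * (\<Sum>y\<in>UNIV. \<pi> $ y * h z y))
      = (\<Sum>y\<in>UNIV. \<pi> $ y * (\<Sum>z\<in>UNIV. P $ x $ z * h z y))"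
    unfolding sum_distrib_left by (subst sum.swap) (simp add: mult_ac)
  also have "\<dots> = (\<Sum>y\<in>UNIV. \<pi> $ y * h x y - \<pi> $ y + (if y = x then 1 else 0))"
    unfolding expect_hit_after_step
  proof (rule sum.cong[OF refl])
    fix y
    show "\<pi> $ y * (h x y - 1 + of_bool (x = y) / \<pi> $ y) = \<pi> $ y * h x y - \<pi> $ y + (if y = x then 1 else 0)"
      using pi_pos[of y] by (auto simp: field_simps)
  qed
  also have "\<dots> = (\<Sum>y\<in>UNIV. \<pi> $ y * h x y)"
    by (simp add: sum.distrib sum_subtractf sum_pi)
  finally show "(\<Sum>z\<in>UNIV. P $ x $ z * (\<Sum>y\<in>UNIV. \<pi> $ y * h z y)) = (\<Sum>y\<in>UNIV. \<pi> $ y * h x y)" .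
qed

definition hit_from_pi :: "'a \<Rightarrow> real" where
  "hit_from_pi y = (\<Sum>x\<in>UNIV. \<pi> $ x * h x y)"

text \<open>Reversibility says that \<open>P\<close> is self-adjoint for the inner product weighted by \<open>\<pi>\<close>.\<close>

lemma transition_self_adjoint:
  "(\<Sum>x\<in>UNIV. \<pi> $ x * f x * (\<Sum>z\<in>UNIV. P $ x $ z * g z))
 = (\<Sum>x\<in>UNIV. \<pi> $ x * g x * (\<Sum>z\<in>UNIV. P $ x $ z * f z))"
proof -
  have r: "\<pi> $ x * P $ x $ z = \<pi> $ z * P $ z $ x" for x z
    using rev unfolding reversible_def by (metis mult.commute)
  have "(\<Sum>x\<in>UNIV. \<pi> $ x * f x * (\<Sum>z\<in>UNIV. P $ x $ z * g z))
      = (\<Sum>x\<in>UNIV. \<Sum>z\<in>UNIV. (\<pi> $ x * P $ x $ z) * (f x * g z))"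
    unfolding sum_distrib_left by (simp add: mult_ac)
  also have "\<dots> = (\<Sum>x\<in>UNIV. \<Sum>z\<in>UNIV. (\<pi> $ z * P $ z $ x) * (f x * g z))"
    by (simp only: r)
  also have "\<dots> = (\<Sum>z\<in>UNIV. \<pi> $ z * g z * (\<Sum>x\<in>UNIV. P $ z $ x * f x))"
    unfolding sum_distrib_left by (subst sum.swap) (simp add: mult_ac)
  finally show ?thesis .
qed

text \<open>Subtracting \<open>hit_from_pi y\<close> normalizes \<open>\<lambda>x. h x y\<close> to have \<open>\<pi>\<close>-mean zero without changing its
  Poisson equation. Green's identity, which is self-adjointness of the Laplacian, applied to two such
  functions with sources \<open>x\<close> and \<open>y\<close> compares the value of each at the source of the other: the
  normalized hitting times are the negative of a symmetric Green function.\<close>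

lemma hit_symmetric: "h x y - hit_from_pi y = h y x - hit_from_pi x"
proof -
  define F where "F u y = h u y - hit_from_pi y" for u y
  have mean0: "(\<Sum>u\<in>UNIV. \<pi> $ u * F u y) = 0" for y
    by (simp add: F_def hit_from_pi_def right_diff_distrib sum_subtractf
        sum_distrib_right[symmetric] sum_pi)
  have PF: "(\<Sum>z\<in>UNIV. P $ u $ z * F z y) = F u y - 1 + of_bool (u = y) / \<pi> $ y" for u y
    by (simp add: F_def right_diff_distrib sum_subtractf expect_hit_after_step
        sum_distrib_right[symmetric] transition_sum[OF P])
  have inner: "(\<Sum>u\<in>UNIV. \<pi> $ u * F u x * (\<Sum>z\<in>UNIV. P $ u $ z * F z y))
      = (\<Sum>u\<in>UNIV. \<pi> $ u * (F u x * F u y)) + F y x" for x y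
  proof -
    have "\<pi> $ u * F u x * (\<Sum>z\<in>UNIV. P $ u $ z * F z y)
        = \<pi> $ u * (F u x * F u y) - \<pi> $ u * F u x + (if u = y then F u x else 0)" for u
      unfolding PF using pi_pos[of u] by (auto simp: field_simps)
    then show ?thesis by (simp add: sum.distrib sum_subtractf mean0)
  qed
  have "F y x = F x y"
    using transition_self_adjoint[of "\<lambda>u. F u x" "\<lambda>u. F u y"] unfolding inner
    by (simp add: mult.commute)
  then show ?thesis by (simp add: F_def)
qed

text \<open>The one-step change of the commute time to \<open>w\<close>. The symmetry of hitting times rewrites the
  average over the target \<open>y\<close> of \<open>h w y\<close> as one over the starting state. Apart from terms depending
  on \<open>x\<close> only, the outcome vanishes unless \<open>w = x\<close>; those terms cancel when two targets are compared.\<close>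

lemma commute_laplacian:
  "(h x w + h w x) - (\<Sum>y\<in>UNIV. P $ x $ y * (h y w + h w y))
 = 2 + hit_from_pi x - (\<Sum>y\<in>UNIV. P $ x $ y * hit_from_pi y) - 2 * of_bool (x = w) / \<pi> $ w"
proof -
  have s: "h w y = h y w - hit_from_pi w + hit_from_pi y" for y
    using hit_symmetric[of w y] by simp
  have "(\<Sum>y\<in>UNIV. P $ x $ y * (h y w + h w y))
      = (\<Sum>y\<in>UNIV. 2 * (P $ x $ y * h y w) - P $ x $ y * hit_from_pi w + P $ x $ y * hit_from_pi y)"
    by (rule sum.cong) (auto simp: s algebra_simps)
  also have "\<dots> = 2 * (\<Sum>y\<in>UNIV. P $ x $ y * h y w) - hit_from_pi w
      + (\<Sum>y\<in>UNIV. P $ x $ y * hit_from_pi y)"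
    by (simp add: sum.distrib sum_subtractf sum_distrib_left[symmetric]
        sum_distrib_right[symmetric] transition_sum[OF P])
  finally show ?thesis using s[of x] by (simp add: expect_hit_after_step)
qed

end

section \<open>Facet distances and the Lemoine point in barycentric coordinates\<close>

lemma affine_hull_image_finite:
  fixes v :: "'a \<Rightarrow> 'e::real_vector"
  assumes "finite A" "inj_on v A"
  shows "affine hull (v ` A) = {\<Sum>x\<in>A. b x *\<^sub>R v x | b. sum b A = 1}"
proof -
  have "affine hull (v ` A) = {y. \<exists>u. sum u (v ` A) = 1 \<and> (\<Sum>p\<in>v ` A. u p *\<^sub>R p) = y}"
    using assms by (simp add: affine_hull_finite)
  also have "\<dots> = {\<Sum>x\<in>A. b x *\<^sub>R v x | b. sum b A = 1}"
  proof (intro equalityI subsetI; clarsimp)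
    fix u :: "'e \<Rightarrow> real" assume "sum u (v ` A) = 1"
    then show "\<exists>b. (\<Sum>p\<in>v ` A. u p *\<^sub>R p) = (\<Sum>x\<in>A. b x *\<^sub>R v x) \<and> sum b A = 1"
      using assms by (intro exI[of _ "u \<circ> v"]) (simp add: sum.reindex)
  next
    fix b :: "'a \<Rightarrow> real" assume "sum b A = 1"
    then show "\<exists>u. sum u (v ` A) = 1 \<and> (\<Sum>p\<in>v ` A. u p *\<^sub>R p) = (\<Sum>x\<in>A. b x *\<^sub>R v x)"
      using assms by (intro exI[of _ "b \<circ> the_inv_into A v"])
        (simp add: sum.reindex the_inv_into_f_f)
  qed
  finally show ?thesis .
qed

text \<open>A simplex of full dimension affinely spans the space.\<close>

lemma barycentric_coordinates_exist:
  fixes v :: "'a::finite \<Rightarrow> 'e::euclidean_space"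
  assumes "simplex_vertices v"
  obtains b where "sum b UNIV = 1" "p = (\<Sum>x\<in>UNIV. b x *\<^sub>R v x)"
proof -
  have inj: "inj v" and ind: "\<not> affine_dependent (range v)" and "CARD('a) = DIM('e) + 1"
    using assms by (auto simp: simplex_vertices_def)
  then have "card (range v) = Suc DIM('e)" by (simp add: card_image)
  then have "affine hull (range v) = UNIV" using ind by (rule affine_independent_span_eq[rotated])
  then have "p \<in> {\<Sum>x\<in>UNIV. b x *\<^sub>R v x | b. sum b UNIV = 1}"
    using affine_hull_image_finite[of UNIV v] inj by auto
  then show ?thesis using that by blast
qed

text \<open>The functional \<open>n \<bullet> _\<close> is constant on the facet opposite to \<open>v x\<close> and exceeds that constant by \<open>c\<close> at
  \<open>v x\<close>, so it differs from the constant by \<open>b x * c\<close> at the point with barycentric coordinates \<open>b\<close>;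
  dividing by the length of \<open>n\<close> gives the distance. The foot of the perpendicular lies in the affine
  hull of the facet, rather than just in a hyperplane containing it, because its own
  \<open>x\<close>-coordinate vanishes.\<close>

lemma infdist_facet:
  fixes v :: "'a::finite \<Rightarrow> 'e::euclidean_space"
  assumes v: "simplex_vertices v"
    and n: "\<And>z w. n \<bullet> (v z - v w) = c * (of_bool (z = x) - of_bool (w = x))" and "c \<noteq> 0"
    and b: "sum b UNIV = 1" and p: "p = (\<Sum>y\<in>UNIV. b y *\<^sub>R v y)"
  shows "infdist p (affine hull (facet v x)) = \<bar>b x * c\<bar> / norm n"
proof -
  have inj: "inj v" and card: "CARD('a) = DIM('e) + 1"
    using v by (auto simp: simplex_vertices_def)
  \<comment> \<open>A Euclidean space here has positive dimension, so the simplex has a second vertex.\<close>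
  obtain w where w: "w \<noteq> x"
  proof (rule ccontr)
    assume "\<not> thesis"
    then have "UNIV = {x}" using that by auto
    then have "CARD('a) = 1" by (metis card_1_singleton_iff One_nat_def)
    then show False using card by simp
  qed
  have "n \<noteq> 0" using n[of x w] w \<open>c \<noteq> 0\<close> by auto
  have coord: "n \<bullet> (\<Sum>y\<in>UNIV. b y *\<^sub>R v y) = n \<bullet> v w + b x * c" if "sum b UNIV = 1" for b
  proof -
    have vertex: "n \<bullet> v y = n \<bullet> v w + (if y = x then c else 0)" for y
      using n[of y w] w by (auto simp: inner_diff_right)
    have "n \<bullet> (\<Sum>y\<in>UNIV. b y *\<^sub>R v y) = (\<Sum>y\<in>UNIV. b y * (n \<bullet> v y))"
      by (simp add: inner_sum_right)
    also have "\<dots> = (\<Sum>y\<in>UNIV. b y * (n \<bullet> v w) + (if y = x then b y * c else 0))"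
    proof (rule sum.cong[OF refl])
      fix y
      show "b y * (n \<bullet> v y) = b y * (n \<bullet> v w) + (if y = x then b y * c else 0)"
        by (subst vertex) (simp add: distrib_left)
    qed
    also have "\<dots> = n \<bullet> v w + b x * c"
      using that by (simp add: sum.distrib sum_distrib_right[symmetric])
    finally show ?thesis .
  qed
  let ?H = "affine hull (v ` (UNIV - {x}))"
  have hull: "affine hull (facet v x) = ?H" by (simp add: facet_def affine_hull_convex_hull)
  have wH: "v w \<in> ?H" using w by (intro hull_inc) auto
  have "?H \<subseteq> {q. n \<bullet> q = n \<bullet> v w}"
  proof (rule hull_minimal)
    show "v ` (UNIV - {x}) \<subseteq> {q. n \<bullet> q = n \<bullet> v w}"
    proof clarify
      fix y assume "y \<noteq> x"
      then have "n \<bullet> (v y - v w) = 0" using n[of y w] w by simp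
      then show "n \<bullet> v y = n \<bullet> v w" by (simp add: inner_diff_right)
    qed
  qed (rule affine_hyperplane)
  then have lower: "\<bar>b x * c\<bar> / norm n \<le> dist p q" if "q \<in> ?H" for q
  proof -
    have "n \<bullet> q = n \<bullet> v w" using \<open>?H \<subseteq> _\<close> that by auto
    then have "n \<bullet> (p - q) = b x * c" using coord[OF b] by (simp add: p inner_diff_right)
    then have "\<bar>b x * c\<bar> \<le> norm n * norm (p - q)" using Cauchy_Schwarz_ineq2[of n "p - q"] by simp
    then show ?thesis using \<open>n \<noteq> 0\<close> by (simp add: dist_norm field_simps)
  qed
  define q where "q = p - (b x * c / (n \<bullet> n)) *\<^sub>R n"
  have "n \<bullet> q = n \<bullet> v w"
    using coord[OF b] \<open>n \<noteq> 0\<close> by (simp add: q_def p inner_diff_right)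
  obtain b' where b': "sum b' UNIV = 1" "q = (\<Sum>y\<in>UNIV. b' y *\<^sub>R v y)"
    using barycentric_coordinates_exist[OF v] by blast
  then have "b' x = 0" using coord[OF b'(1)] \<open>n \<bullet> q = n \<bullet> v w\<close> \<open>c \<noteq> 0\<close> by simp
  then have "sum b' (UNIV - {x}) = 1" "q = (\<Sum>y\<in>UNIV - {x}. b' y *\<^sub>R v y)"
    using b' by (simp_all add: sum_diff1)
  then have qH: "q \<in> ?H"
    using affine_hull_image_finite[of "UNIV - {x}" v] inj by (auto intro: inj_on_subset)
  have "dist p q = \<bar>b x * c\<bar> / norm n"
    using \<open>n \<noteq> 0\<close> by (simp add: dist_norm q_def dot_square_norm power2_eq_square)
  then have "infdist p ?H \<le> \<bar>b x * c\<bar> / norm n" using infdist_le[OF qH, of p] by simp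
  moreover have "\<bar>b x * c\<bar> / norm n \<le> infdist p ?H"
  proof -
    have "?H \<noteq> {}" using wH by blast
    then show ?thesis
      unfolding infdist_notempty[OF \<open>?H \<noteq> {}\<close>] by (rule cINF_greatest) (rule lower)
  qed
  ultimately show ?thesis by (simp add: hull)
qed

text \<open>If the squared height over the facet opposite to \<open>v x\<close> is \<open>1 / w x\<close> and the \<open>w x\<close> add up to one, then
  completing the square on the constraint \<open>\<Sum>x. b x = 1\<close> turns the sum of squared distances into
  \<open>1 + (\<Sum>x. (b x - w x)\<^sup>2 / w x)\<close>, whose only minimizer is \<open>b = w\<close>.\<close>

lemma lemoine_point_eq:
  fixes v :: "'a::finite \<Rightarrow> 'e::euclidean_space"
  assumes v: "simplex_vertices v" and l: "is_lemoine_point v l"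
    and w: "\<And>x. 0 < w x" "sum w UNIV = 1"
    and d: "\<And>b x. sum b UNIV = 1 \<Longrightarrow>
      (infdist (\<Sum>y\<in>UNIV. b y *\<^sub>R v y) (affine hull (facet v x)))\<^sup>2 = (b x)\<^sup>2 / w x"
  shows "l = (\<Sum>x\<in>UNIV. w x *\<^sub>R v x)"
proof -
  let ?f = "\<lambda>p. \<Sum>x\<in>UNIV. (infdist p (affine hull (facet v x)))\<^sup>2"
  have f: "?f (\<Sum>y\<in>UNIV. b y *\<^sub>R v y) = 1 + (\<Sum>x\<in>UNIV. (b x - w x)\<^sup>2 / w x)"
    if "sum b UNIV = 1" for b
  proof -
    have "(b x)\<^sup>2 / w x = (2 * b x - w x) + (b x - w x)\<^sup>2 / w x" for x
      using w(1)[of x] by (simp add: field_simps power2_eq_square)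
    then have "?f (\<Sum>y\<in>UNIV. b y *\<^sub>R v y) = (\<Sum>x\<in>UNIV. (2 * b x - w x) + (b x - w x)\<^sup>2 / w x)"
      by (simp add: d[OF that])
    also have "\<dots> = 1 + (\<Sum>x\<in>UNIV. (b x - w x)\<^sup>2 / w x)"
      by (simp add: sum.distrib sum_subtractf sum_distrib_left[symmetric] that w(2))
    finally show ?thesis .
  qed
  obtain b where b: "sum b UNIV = 1" "l = (\<Sum>x\<in>UNIV. b x *\<^sub>R v x)"
    using barycentric_coordinates_exist[OF v] by blast
  have "?f l \<le> ?f (\<Sum>x\<in>UNIV. w x *\<^sub>R v x)"
    using l unfolding is_lemoine_point_def is_arg_min_linorder by blast
  then have "(\<Sum>x\<in>UNIV. (b x - w x)\<^sup>2 / w x) \<le> 0"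
    unfolding b(2) f[OF b(1)] f[OF w(2)] by simp
  moreover have nonneg: "0 \<le> (b x - w x)\<^sup>2 / w x" for x using w(1)[of x] by simp
  ultimately have "(\<Sum>x\<in>UNIV. (b x - w x)\<^sup>2 / w x) = 0"
    by (intro antisym sum_nonneg) auto
  then have zero: "(b x - w x)\<^sup>2 / w x = 0" for x
    using sum_nonneg_eq_0_iff[of UNIV "\<lambda>x. (b x - w x)\<^sup>2 / w x"] nonneg by simp
  have "b x = w x" for x using zero[of x] w(1)[of x] by simp
  then show ?thesis by (simp add: b(2))
qed

text \<open>The parallel axis theorem for finitely many weighted points.\<close>

lemma leibniz_identity:
  fixes v :: "'a \<Rightarrow> 'e::real_inner"
  assumes "sum w A = 1"
  shows "(\<Sum>x\<in>A. w x * (norm (p - v x))\<^sup>2)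
    = (norm (p - (\<Sum>x\<in>A. w x *\<^sub>R v x)))\<^sup>2
      + (\<Sum>x\<in>A. w x * (norm ((\<Sum>x\<in>A. w x *\<^sub>R v x) - v x))\<^sup>2)"
proof -
  define l where "l = (\<Sum>x\<in>A. w x *\<^sub>R v x)"
  have sq: "(norm (p - v x))\<^sup>2 = (norm (p - l))\<^sup>2 + 2 * ((p - l) \<bullet> (l - v x)) + (norm (l - v x))\<^sup>2" for x
    unfolding power2_norm_eq_inner by (simp add: inner_diff_left inner_diff_right inner_commute)
  have "(\<Sum>x\<in>A. w x * (norm (p - v x))\<^sup>2)
      = (\<Sum>x\<in>A. w x * (norm (p - l))\<^sup>2 + 2 * ((p - l) \<bullet> (w x *\<^sub>R l - w x *\<^sub>R v x)) + w x * (norm (l - v x))\<^sup>2)"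
    unfolding sq by (rule sum.cong) (simp_all add: algebra_simps inner_diff_right)
  also have "\<dots> = (norm (p - l))\<^sup>2 + 2 * ((p - l) \<bullet> (\<Sum>x\<in>A. w x *\<^sub>R l - w x *\<^sub>R v x))
      + (\<Sum>x\<in>A. w x * (norm (l - v x))\<^sup>2)"
    by (simp add: sum.distrib sum_distrib_left[symmetric] sum_distrib_right[symmetric] assms
        inner_sum_right)
  also have "(\<Sum>x\<in>A. w x *\<^sub>R l - w x *\<^sub>R v x) = 0"
    by (simp add: sum_subtractf scaleR_sum_left[symmetric] assms l_def)
  finally show ?thesis by (simp add: l_def)
qed

section \<open>The simplex of commute times\<close>

context reversible_hitting
begin

text \<open>By polarization the inner product of two differences of vertices is a combination of commute times.
  Averaging over the step from \<open>x\<close> to \<open>y\<close> leaves the difference of the one-step changes of the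
  commute times to \<open>w\<close> and to \<open>z\<close>.\<close>

lemma facet_normal_inner:
  fixes v :: "'a \<Rightarrow> 'e::real_inner"
  assumes c: "\<And>x y. (norm (v x - v y))\<^sup>2 = h x y + h y x"
  defines "n \<equiv> \<lambda>x. \<Sum>y\<in>UNIV. P $ x $ y *\<^sub>R (v x - v y)"
  shows "n x \<bullet> (v z - v w) = (1 / \<pi> $ x) * (of_bool (z = x) - of_bool (w = x))"
proof -
  have polar: "(a - b) \<bullet> (d - e) = ((norm (a - e))\<^sup>2 + (norm (b - d))\<^sup>2 - (norm (a - d))\<^sup>2 - (norm (b - e))\<^sup>2) / 2"
    for a b d e :: 'e
    unfolding power2_norm_eq_inner by (simp add: inner_diff_left inner_diff_right inner_commute)
  let ?c = "\<lambda>y w. h y w + h w y"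
  have "n x \<bullet> (v z - v w) = (\<Sum>y\<in>UNIV. P $ x $ y * ((?c x w + ?c y z - ?c x z - ?c y w) / 2))"
    by (simp add: n_def inner_sum_left polar c)
  also have "\<dots> = (\<Sum>y\<in>UNIV. (P $ x $ y * (?c x w - ?c x z) + P $ x $ y * ?c y z - P $ x $ y * ?c y w) / 2)"
    by (rule sum.cong) (auto simp: field_simps)
  also have "\<dots> = ((?c x w - ?c x z) + (\<Sum>y\<in>UNIV. P $ x $ y * ?c y z) - (\<Sum>y\<in>UNIV. P $ x $ y * ?c y w)) / 2"
    unfolding sum_divide_distrib[symmetric] sum_subtractf sum.distrib sum_distrib_right[symmetric]
    by (simp add: transition_sum[OF P])
  also have "\<dots> = (1 / \<pi> $ x) * (of_bool (z = x) - of_bool (w = x))"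
    using commute_laplacian[of x w] commute_laplacian[of x z] by auto
  finally show ?thesis .
qed

text \<open>The normal is itself an average of edge vectors \<open>v x - v y\<close>, each of which has inner product
  \<open>1 / \<pi> x\<close> with it. Only a loop at \<open>x\<close> would contribute the zero edge and make the norm smaller.\<close>

lemma facet_normal_norm:
  fixes v :: "'a \<Rightarrow> 'e::real_inner"
  assumes c: "\<And>x y. (norm (v x - v y))\<^sup>2 = h x y + h y x" and "P $ x $ x = 0"
  shows "(norm (\<Sum>y\<in>UNIV. P $ x $ y *\<^sub>R (v x - v y)))\<^sup>2 = 1 / \<pi> $ x"
proof -
  let ?n = "\<Sum>y\<in>UNIV. P $ x $ y *\<^sub>R (v x - v y)"
  have "(norm ?n)\<^sup>2 = (\<Sum>y\<in>UNIV. P $ x $ y * (?n \<bullet> (v x - v y)))"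
    by (simp only: power2_norm_eq_inner inner_sum_right[of ?n] inner_scaleR_right)
  also have "\<dots> = (\<Sum>y\<in>UNIV. P $ x $ y * (1 / \<pi> $ x))"
  proof (rule sum.cong[OF refl])
    fix y
    show "P $ x $ y * (?n \<bullet> (v x - v y)) = P $ x $ y * (1 / \<pi> $ x)"
      using assms(2) by (cases "y = x") (auto simp: facet_normal_inner[OF c])
  qed
  finally show ?thesis by (simp add: sum_divide_distrib[symmetric] transition_sum[OF P])
qed

lemma lemoine_point_commute_simplex:
  fixes v :: "'a \<Rightarrow> 'e::euclidean_space"
  assumes c: "\<And>x y. (norm (v x - v y))\<^sup>2 = h x y + h y x"
    and "loop_free_matrix P" and v: "simplex_vertices v" and l: "is_lemoine_point v l"
  shows "l = (\<Sum>x\<in>UNIV. \<pi> $ x *\<^sub>R v x)"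
proof (rule lemoine_point_eq[OF v l pi_pos sum_pi])
  fix b :: "'a \<Rightarrow> real" and x assume b: "sum b UNIV = 1"
  define n where "n = (\<Sum>y\<in>UNIV. P $ x $ y *\<^sub>R (v x - v y))"
  have "P $ x $ x = 0" using assms(2) by (simp add: loop_free_matrix_def)
  then have nn: "(norm n)\<^sup>2 = 1 / \<pi> $ x" unfolding n_def by (rule facet_normal_norm[OF c])
  have "infdist (\<Sum>y\<in>UNIV. b y *\<^sub>R v y) (affine hull (facet v x)) = \<bar>b x * (1 / \<pi> $ x)\<bar> / norm n"
    unfolding n_def using pi_pos[of x] by (intro infdist_facet[OF v facet_normal_inner[OF c] _ b]) auto
  then have "(infdist (\<Sum>y\<in>UNIV. b y *\<^sub>R v y) (affine hull (facet v x)))\<^sup>2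
      = (b x * (1 / \<pi> $ x))\<^sup>2 / (1 / \<pi> $ x)"
    by (simp only: power_divide power2_abs nn)
  then show "(infdist (\<Sum>y\<in>UNIV. b y *\<^sub>R v y) (affine hull (facet v x)))\<^sup>2 = (b x)\<^sup>2 / \<pi> $ x"
    using pi_pos[of x] by (simp add: power_mult_distrib power2_eq_square)
qed

text \<open>Both sides are the moment of inertia \<open>I\<close> of the vertices, weighted by \<open>\<pi>\<close>, about the Lemoine
  point: the right-hand side by Leibniz's identity at the circumcenter, the left-hand side by averaging
  that identity over the vertices.\<close>

lemma kemeny_eq_circumradius:
  fixes v :: "'a \<Rightarrow> 'e::euclidean_space"
  assumes c: "\<And>x y. (norm (v x - v y))\<^sup>2 = h x y + h y x"
    and "loop_free_matrix P" and v: "simplex_vertices v" and l: "is_lemoine_point v l"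
    and \<gamma>: "is_circumcenter v \<gamma> R"
  shows "(\<Sum>y\<in>UNIV. \<pi> $ y * h x y) = R\<^sup>2 - (norm (\<gamma> - l))\<^sup>2"
proof -
  define K where "K = (\<Sum>y\<in>UNIV. \<pi> $ y * h x y)"
  have K: "(\<Sum>y\<in>UNIV. \<pi> $ y * h u y) = K" for u unfolding K_def by (rule kemeny_sum_const)
  have l_eq: "l = (\<Sum>x\<in>UNIV. \<pi> $ x *\<^sub>R v x)"
    by (rule lemoine_point_commute_simplex[OF c assms(2) v l])
  define I where "I = (\<Sum>y\<in>UNIV. \<pi> $ y * (norm (l - v y))\<^sup>2)"
  note leibniz = leibniz_identity[OF sum_pi, of _ v, folded l_eq, folded I_def]
  have "(\<Sum>y\<in>UNIV. \<pi> $ y * (norm (\<gamma> - v y))\<^sup>2) = R\<^sup>2"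
    using \<gamma> by (simp add: is_circumcenter_def dist_norm sum_distrib_right[symmetric] sum_pi)
  then have "R\<^sup>2 - (norm (\<gamma> - l))\<^sup>2 = I" using leibniz[of \<gamma>] by simp
  moreover
  have "(\<Sum>u\<in>UNIV. \<pi> $ u * (\<Sum>y\<in>UNIV. \<pi> $ y * (norm (v u - v y))\<^sup>2)) = 2 * I"
  proof -
    have "(\<Sum>u\<in>UNIV. \<pi> $ u * (\<Sum>y\<in>UNIV. \<pi> $ y * (norm (v u - v y))\<^sup>2))
        = (\<Sum>u\<in>UNIV. \<pi> $ u * (norm (l - v u))\<^sup>2 + \<pi> $ u * I)"
      unfolding leibniz by (rule sum.cong) (auto simp: algebra_simps norm_minus_commute)
    then show ?thesis by (simp add: sum.distrib sum_distrib_right[symmetric] sum_pi I_def)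
  qed
  moreover
  have "(\<Sum>u\<in>UNIV. \<pi> $ u * (\<Sum>y\<in>UNIV. \<pi> $ y * (norm (v u - v y))\<^sup>2)) = 2 * K"
  proof -
    have "(\<Sum>u\<in>UNIV. \<pi> $ u * (\<Sum>y\<in>UNIV. \<pi> $ y * (norm (v u - v y))\<^sup>2))
        = (\<Sum>u\<in>UNIV. \<pi> $ u * (\<Sum>y\<in>UNIV. \<pi> $ y * h u y))
          + (\<Sum>u\<in>UNIV. \<Sum>y\<in>UNIV. \<pi> $ u * (\<pi> $ y * h y u))"
      unfolding c by (simp add: distrib_left sum.distrib sum_distrib_left)
    also have "(\<Sum>u\<in>UNIV. \<Sum>y\<in>UNIV. \<pi> $ u * (\<pi> $ y * h y u))
        = (\<Sum>y\<in>UNIV. \<pi> $ y * (\<Sum>u\<in>UNIV. \<pi> $ u * h y u))"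
      by (subst sum.swap) (simp add: sum_distrib_left mult_ac)
    finally show ?thesis by (simp add: K sum_distrib_right[symmetric] sum_pi)
  qed
  ultimately show ?thesis by (simp add: K_def)
qed

end

theorem theorem1p1:
  fixes P :: "real ^ ('a::finite) ^ 'a"
    and \<pi> :: "real ^ 'a"
    and M :: "'a \<Rightarrow> 'w measure"
    and X :: "'a \<Rightarrow> nat \<Rightarrow> 'w \<Rightarrow> 'a"
    and v :: "'a \<Rightarrow> 'e::euclidean_space"
    and \<gamma> \<l> :: 'e
    and R :: real
  assumes "transition_matrix P"
    and "irreducible_aperiodic P"
    and "loop_free_matrix P"
    and "stationary_distribution P \<pi>"
    and "reversible P \<pi>"
    and "\<And>x. markov_chain_from (M x) (X x) P x"
    and "simplex_vertices v"
    and "\<And>x y. (norm (v x - v y))\<^sup>2 = commute_time M X x y"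
    and "is_circumcenter v \<gamma> R"
    and "is_lemoine_point v \<l>"
  shows "kemeny_constant M X \<pi> = R\<^sup>2 - (norm (\<gamma> - \<l>))\<^sup>2"
proof -
  have hit: "hitting_time M X x y = (\<Sum>k. avoid_prob P y k x)" for x y
    unfolding hitting_time_def by (rule expected_hit_eq_suminf[OF assms(1,2) assms(6)])
  interpret reversible_hitting P \<pi> "hitting_time M X"
  proof
    fix x y :: 'a assume "x \<noteq> y"
    then show "hitting_time M X x y = 1 + (\<Sum>z\<in>UNIV. P $ x $ z * hitting_time M X z y)"
      unfolding hit by (rule suminf_avoid_prob_step[OF assms(1,2)])
  qed (use assms in \<open>simp_all add: hit\<close>)
  have "(\<Sum>y\<in>UNIV. \<pi> $ y * hitting_time M X x y) = R\<^sup>2 - (norm (\<gamma> - \<l>))\<^sup>2" for x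
    using assms by (intro kemeny_eq_circumradius[of v]) (auto simp: commute_time_def)
  then show ?thesis unfolding kemeny_constant_def by simp
qed

end
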